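(* Let $A$ and $R$ be commutative rings with unity, let $i:A\to R$ be a morphism of rings with unity, let $M$ be an $R$-module and let $\Gamma$ be a commutative monoid of finite type. Let $D\in\operatorname{Der}_A(R,M)$ and let $\delta:\Gamma\to(M,+)$ be a morphism of monoids. Then $$\widetilde D:\mathcal F(\Gamma,R)\to\mathcal F(\Gamma,M),\quad \widetilde D(\alpha)(n)=D(\alpha(n))+\alpha(n)\delta(n)\ \text{ for all } n\in\Gamma,$$ is an $A$-derivation. Consequently, there is a natural map $$\operatorname{Der}_A(R,M)\otimes_R \operatorname{Hom}_R(\Gamma,M)\to\operatorname{Der}_A(\mathcal F(\Gamma,R),\mathcal F(\Gamma,M)),\quad D\otimes\delta\mapsto\widetilde D,$$ where $\operatorname{Hom}_R(\Gamma,M)$ has the natural structure of an $R$-module given by $(r\cdot\delta)(n)=r\delta(n)$ for all $r\in R$, $\delta\in\operatorname{Hom}_R(\Gamma,M)$ and $n\in\Gamma$.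
   Context: A monoid $(\Gamma,\cdot,1)$ is of finite type if for each $n\in\Gamma$ the set $\{(a,b)\in\Gamma\times\Gamma : n=ab\}$ is finite. $\mathcal F(\Gamma,R)$ is the set of all functions $\alpha:\Gamma\to R$, a commutative ring with unity under pointwise addition and $(\alpha\cdot\beta)(n)=\sum_{ab=n}\alpha(a)\beta(b)$. It is an $R$-algebra via the map sending $r\in R$ to the function with value $r$ at $1$ and $0$ elsewhere, and hence an $A$-algebra via $i:A\to R$. For an $R$-module $M$, $\mathcal F(\Gamma,M)$ is the set of all functions $f:\Gamma\to M$, an $\mathcal F(\Gamma,R)$-module under pointwise addition and $(\alpha\cdot f)(n)=\sum_{ab=n}\alpha(a)f(b)$. For an $A$-algebra $S$ and an $S$-module $N$, an $A$-derivation $D:S\to N$ is an $A$-linear map with $D(fg)=fD(g)+gD(f)$ for all $f,g\in S$; $\operatorname{Der}_A(S,N)$ denotes the $S$-module of these. $\operatorname{Hom}_R(\Gamma,M)$ denotes the set of monoid morphisms $\delta:(\Gamma,\cdot)\to(M,+)$, with pointwise addition.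
   Formalization: The tensor product Der_A(R,M) ⊗_R Hom_R(Γ,M) is replaced by the direct sum, with (D,δ) ↦ D̃ shown R-linear; on the tensor product the rule is ill-defined, since 0⊗δ = 0⊗0 but the induced maps α·δ and 0 differ (e.g. A=R=M=ℤ, Γ=ℕ, δ=id). *)

theory Defs
  imports "HOL-Algebra.Module"
begin

section \<open>Function rings and modules over a monoid of finite type\<close>

definition factorizations :: "('g, 'y) monoid_scheme \<Rightarrow> 'g \<Rightarrow> ('g \<times> 'g) set" where
  "factorizations \<Gamma> n = {(a, b) \<in> carrier \<Gamma> \<times> carrier \<Gamma>. n = a \<otimes>\<^bsub>\<Gamma>\<^esub> b}"

definition finite_type :: "('g, 'y) monoid_scheme \<Rightarrow> bool" where
  "finite_type \<Gamma> \<longleftrightarrow> (\<forall>n \<in> carrier \<Gamma>. finite (factorizations \<Gamma> n))"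

text \<open>All function spaces below consist of extensional functions (undefined outside the
  domain), so that HOL equality is equality of functions on the carrier.\<close>

definition fun_ring :: "('g, 'y) monoid_scheme \<Rightarrow> ('r, 'x) ring_scheme \<Rightarrow> ('g \<Rightarrow> 'r) ring" where
  "fun_ring \<Gamma> R =
    \<lparr>carrier = carrier \<Gamma> \<rightarrow>\<^sub>E carrier R,
     monoid.mult = (\<lambda>\<alpha> \<beta>. \<lambda>n\<in>carrier \<Gamma>. \<Oplus>\<^bsub>R\<^esub>p\<in>factorizations \<Gamma> n. \<alpha> (fst p) \<otimes>\<^bsub>R\<^esub> \<beta> (snd p)),
     one = (\<lambda>n\<in>carrier \<Gamma>. if n = \<one>\<^bsub>\<Gamma>\<^esub> then \<one>\<^bsub>R\<^esub> else \<zero>\<^bsub>R\<^esub>),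
     ring.zero = (\<lambda>n\<in>carrier \<Gamma>. \<zero>\<^bsub>R\<^esub>),
     add = (\<lambda>\<alpha> \<beta>. \<lambda>n\<in>carrier \<Gamma>. \<alpha> n \<oplus>\<^bsub>R\<^esub> \<beta> n)\<rparr>"

definition fun_const :: "('g, 'y) monoid_scheme \<Rightarrow> ('r, 'x) ring_scheme \<Rightarrow> 'r \<Rightarrow> ('g \<Rightarrow> 'r)" where
  "fun_const \<Gamma> R r = (\<lambda>n\<in>carrier \<Gamma>. if n = \<one>\<^bsub>\<Gamma>\<^esub> then r else \<zero>\<^bsub>R\<^esub>)"

text \<open>The type of module records extends that of rings; the locale \<^locale>\<open>module\<close> ignores
  the multiplicative fields of the module, which are left undefined here.\<close>

definition fun_module ::
  "('g, 'y) monoid_scheme \<Rightarrow> ('r, 'm, 'z) module_scheme \<Rightarrow> ('g \<Rightarrow> 'r, 'g \<Rightarrow> 'm) module" where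
  "fun_module \<Gamma> M =
    \<lparr>carrier = carrier \<Gamma> \<rightarrow>\<^sub>E carrier M,
     monoid.mult = undefined,
     one = undefined,
     ring.zero = (\<lambda>n\<in>carrier \<Gamma>. \<zero>\<^bsub>M\<^esub>),
     add = (\<lambda>f g. \<lambda>n\<in>carrier \<Gamma>. f n \<oplus>\<^bsub>M\<^esub> g n),
     smult = (\<lambda>\<alpha> f. \<lambda>n\<in>carrier \<Gamma>. \<Oplus>\<^bsub>M\<^esub>p\<in>factorizations \<Gamma> n. \<alpha> (fst p) \<odot>\<^bsub>M\<^esub> f (snd p))\<rparr>"

section \<open>Derivations\<close>

text \<open>An \<open>A\<close>-algebra \<open>S\<close> is given by its structure morphism \<open>j : A \<rightarrow> S\<close>; then \<open>A\<close> acts on an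
  \<open>S\<close>-module through \<open>j\<close>.\<close>

definition derivations ::
  "('a, 'w) ring_scheme \<Rightarrow> ('s, 'x) ring_scheme \<Rightarrow> ('a \<Rightarrow> 's) \<Rightarrow> ('s, 'n, 'z) module_scheme
    \<Rightarrow> ('s \<Rightarrow> 'n) set" where
  "derivations A S j N = {D \<in> carrier S \<rightarrow>\<^sub>E carrier N.
     (\<forall>f\<in>carrier S. \<forall>g\<in>carrier S. D (f \<oplus>\<^bsub>S\<^esub> g) = D f \<oplus>\<^bsub>N\<^esub> D g) \<and>
     (\<forall>a\<in>carrier A. \<forall>f\<in>carrier S. D (j a \<otimes>\<^bsub>S\<^esub> f) = j a \<odot>\<^bsub>N\<^esub> D f) \<and>
     (\<forall>f\<in>carrier S. \<forall>g\<in>carrier S. D (f \<otimes>\<^bsub>S\<^esub> g) = f \<odot>\<^bsub>N\<^esub> D g \<oplus>\<^bsub>N\<^esub> g \<odot>\<^bsub>N\<^esub> D f)}"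

definition Der ::
  "('a, 'w) ring_scheme \<Rightarrow> ('s, 'x) ring_scheme \<Rightarrow> ('a \<Rightarrow> 's) \<Rightarrow> ('s, 'n, 'z) module_scheme
    \<Rightarrow> ('s, 's \<Rightarrow> 'n) module" where
  "Der A S j N =
    \<lparr>carrier = derivations A S j N,
     monoid.mult = undefined,
     one = undefined,
     ring.zero = (\<lambda>f\<in>carrier S. \<zero>\<^bsub>N\<^esub>),
     add = (\<lambda>D E. \<lambda>f\<in>carrier S. D f \<oplus>\<^bsub>N\<^esub> E f),
     smult = (\<lambda>s D. \<lambda>f\<in>carrier S. s \<odot>\<^bsub>N\<^esub> D f)\<rparr>"

section \<open>Monoid morphisms into a module\<close>

definition monoid_homs :: "('g, 'y) monoid_scheme \<Rightarrow> ('r, 'm, 'z) module_scheme \<Rightarrow> ('g \<Rightarrow> 'm) set" where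
  "monoid_homs \<Gamma> M =
    {\<delta> \<in> carrier \<Gamma> \<rightarrow>\<^sub>E carrier M. \<delta> \<in> hom \<Gamma> (add_monoid M) \<and> \<delta> \<one>\<^bsub>\<Gamma>\<^esub> = \<zero>\<^bsub>M\<^esub>}"

definition Hom_mod ::
  "('g, 'y) monoid_scheme \<Rightarrow> ('r, 'm, 'z) module_scheme \<Rightarrow> ('r, 'g \<Rightarrow> 'm) module" where
  "Hom_mod \<Gamma> M =
    \<lparr>carrier = monoid_homs \<Gamma> M,
     monoid.mult = undefined,
     one = undefined,
     ring.zero = (\<lambda>n\<in>carrier \<Gamma>. \<zero>\<^bsub>M\<^esub>),
     add = (\<lambda>\<delta> \<epsilon>. \<lambda>n\<in>carrier \<Gamma>. \<delta> n \<oplus>\<^bsub>M\<^esub> \<epsilon> n),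
     smult = (\<lambda>r \<delta>. \<lambda>n\<in>carrier \<Gamma>. r \<odot>\<^bsub>M\<^esub> \<delta> n)\<rparr>"

section \<open>Module constructions\<close>

definition module_sum ::
  "('r, 'm, 'z) module_scheme \<Rightarrow> ('r, 'n, 'u) module_scheme \<Rightarrow> ('r, 'm \<times> 'n) module" where
  "module_sum M N =
    \<lparr>carrier = carrier M \<times> carrier N,
     monoid.mult = undefined,
     one = undefined,
     ring.zero = (\<zero>\<^bsub>M\<^esub>, \<zero>\<^bsub>N\<^esub>),
     add = (\<lambda>x y. (fst x \<oplus>\<^bsub>M\<^esub> fst y, snd x \<oplus>\<^bsub>N\<^esub> snd y)),
     smult = (\<lambda>r x. (r \<odot>\<^bsub>M\<^esub> fst x, r \<odot>\<^bsub>N\<^esub> snd x))\<rparr>"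

definition restrict_scalars ::
  "('r \<Rightarrow> 's) \<Rightarrow> ('s, 'n, 'z) module_scheme \<Rightarrow> ('r, 'n) module" where
  "restrict_scalars h N =
    \<lparr>carrier = carrier N, monoid.mult = monoid.mult N, one = one N, ring.zero = ring.zero N, add = add N,
     smult = (\<lambda>r x. h r \<odot>\<^bsub>N\<^esub> x)\<rparr>"

locale module_morphism = dom: module R M + cod: module R N
  for R :: "('r, 'x) ring_scheme" and M :: "('r, 'm, 'z) module_scheme"
    and N :: "('r, 'n, 'u) module_scheme" +
  fixes \<phi> :: "'m \<Rightarrow> 'n"
  assumes closed: "x \<in> carrier M \<Longrightarrow> \<phi> x \<in> carrier N"
    and additive: "\<lbrakk>x \<in> carrier M; y \<in> carrier M\<rbrakk> \<Longrightarrow> \<phi> (x \<oplus>\<^bsub>M\<^esub> y) = \<phi> x \<oplus>\<^bsub>N\<^esub> \<phi> y"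
    and homogeneous: "\<lbrakk>r \<in> carrier R; x \<in> carrier M\<rbrakk> \<Longrightarrow> \<phi> (r \<odot>\<^bsub>M\<^esub> x) = r \<odot>\<^bsub>N\<^esub> \<phi> x"

section \<open>The derivation induced by a derivation and a monoid morphism\<close>

definition induced_der ::
  "('g, 'y) monoid_scheme \<Rightarrow> ('r, 'x) ring_scheme \<Rightarrow> ('r, 'm, 'z) module_scheme
    \<Rightarrow> ('r \<Rightarrow> 'm) \<Rightarrow> ('g \<Rightarrow> 'm) \<Rightarrow> ('g \<Rightarrow> 'r) \<Rightarrow> ('g \<Rightarrow> 'm)" where
  "induced_der \<Gamma> R M D \<delta> =
    (\<lambda>\<alpha>\<in>carrier (fun_ring \<Gamma> R). \<lambda>n\<in>carrier \<Gamma>. D (\<alpha> n) \<oplus>\<^bsub>M\<^esub> \<alpha> n \<odot>\<^bsub>M\<^esub> \<delta> n)"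

text \<open>The pair \<open>(D, \<delta>)\<close> is sent to its induced derivation by an \<open>R\<close>-linear map on the direct sum
  of the two modules. This map is not bilinear, so it does not factor through their tensor product
  over \<open>R\<close>: the following lemma shows that a map \<open>T\<close> with \<open>T (D \<otimes> \<delta>) = induced_der D \<delta>\<close> exists
  only if both modules are zero, whatever target \<open>T\<close> is defined on, as soon as
  \<open>(r D) \<otimes> \<delta> = D \<otimes> (r \<delta>)\<close>.\<close>

lemma induced_der_tensor_trivial:
  fixes t :: "('r \<Rightarrow> 'm) \<Rightarrow> ('g \<Rightarrow> 'm) \<Rightarrow> 't" and T :: "'t \<Rightarrow> (('g \<Rightarrow> 'r) \<Rightarrow> ('g \<Rightarrow> 'm))"
  assumes "i \<in> ring_hom A R" and "module R M" and "comm_monoid \<Gamma>"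
    and balanced: "\<And>r D \<delta>. \<lbrakk>r \<in> carrier R; D \<in> derivations A R i M; \<delta> \<in> monoid_homs \<Gamma> M\<rbrakk>
      \<Longrightarrow> t (r \<odot>\<^bsub>Der A R i M\<^esub> D) \<delta> = t D (r \<odot>\<^bsub>Hom_mod \<Gamma> M\<^esub> \<delta>)"
    and T: "\<And>D \<delta>. \<lbrakk>D \<in> derivations A R i M; \<delta> \<in> monoid_homs \<Gamma> M\<rbrakk>
      \<Longrightarrow> T (t D \<delta>) = induced_der \<Gamma> R M D \<delta>"
  shows "derivations A R i M = {\<zero>\<^bsub>Der A R i M\<^esub>}" and "monoid_homs \<Gamma> M = {\<zero>\<^bsub>Hom_mod \<Gamma> M\<^esub>}"
proof -
  interpret module R M by fact
  interpret G: comm_monoid \<Gamma> by fact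
  have ic: "i a \<in> carrier R" if "a \<in> carrier A" for a
    using assms(1) that by (rule ring_hom_closed)
  let ?D0 = "\<zero>\<^bsub>Der A R i M\<^esub>" and ?d0 = "\<zero>\<^bsub>Hom_mod \<Gamma> M\<^esub>"
  have D0: "?D0 \<in> derivations A R i M"
    by (auto simp: derivations_def Der_def ic)
  have d0: "?d0 \<in> monoid_homs \<Gamma> M"
    by (auto simp: monoid_homs_def Hom_mod_def hom_def)
  have zD: "\<zero>\<^bsub>R\<^esub> \<odot>\<^bsub>Der A R i M\<^esub> D = ?D0" if "D \<in> derivations A R i M" for D
    using that by (auto simp: derivations_def Der_def PiE_iff intro!: restrict_ext)
  have zd: "\<zero>\<^bsub>R\<^esub> \<odot>\<^bsub>Hom_mod \<Gamma> M\<^esub> \<delta> = ?d0" if "\<delta> \<in> monoid_homs \<Gamma> M" for \<delta>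
    using that by (auto simp: monoid_homs_def Hom_mod_def PiE_iff intro!: restrict_ext)
  have eq: "induced_der \<Gamma> R M ?D0 \<delta> = induced_der \<Gamma> R M D ?d0"
    if "D \<in> derivations A R i M" "\<delta> \<in> monoid_homs \<Gamma> M" for D \<delta>
    using balanced[OF R.zero_closed that] T[OF D0 that(2)] T[OF that(1) d0] zD[OF that(1)] zd[OF that(2)]
    by simp
  have val: "induced_der \<Gamma> R M D \<delta> (\<lambda>n\<in>carrier \<Gamma>. r) n = D r \<oplus>\<^bsub>M\<^esub> r \<odot>\<^bsub>M\<^esub> \<delta> n"
    if "r \<in> carrier R" "n \<in> carrier \<Gamma>" for D \<delta> r n
    using that by (simp add: induced_der_def fun_ring_def)
  have "D = ?D0" if D: "D \<in> derivations A R i M" for D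
  proof (rule extensionalityI[of _ "carrier R"])
    show "D r = ?D0 r" if "r \<in> carrier R" for r
      using fun_cong[OF fun_cong[OF eq[OF D d0]], of "\<lambda>n\<in>carrier \<Gamma>. r" "\<one>\<^bsub>\<Gamma>\<^esub>"] that D
      by (auto simp: val derivations_def Der_def Hom_mod_def PiE_iff)
  qed (use D in \<open>auto simp: derivations_def Der_def PiE_iff\<close>)
  with D0 show "derivations A R i M = {?D0}" by blast
  have "\<delta> = ?d0" if d: "\<delta> \<in> monoid_homs \<Gamma> M" for \<delta>
  proof (rule extensionalityI[of _ "carrier \<Gamma>"])
    show "\<delta> n = ?d0 n" if "n \<in> carrier \<Gamma>" for n
      using fun_cong[OF fun_cong[OF eq[OF D0 d]], of "\<lambda>n\<in>carrier \<Gamma>. \<one>\<^bsub>R\<^esub>" n] that d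
      by (auto simp: val monoid_homs_def Der_def Hom_mod_def PiE_iff)
  qed (use d in \<open>auto simp: monoid_homs_def Hom_mod_def PiE_iff\<close>)
  with d0 show "monoid_homs \<Gamma> M = {?d0}" by blast
qed

end

theory Submission
  imports Defs
begin

text \<open>
  At each \<open>n\<close> the Leibniz rule for the induced map compares two sums over the factorizations
  \<open>n = a b\<close>. Since \<open>D\<close> is additive and \<open>\<delta> (a b) = \<delta> a + \<delta> b\<close>, the left-hand side
  \<open>D ((\<alpha> \<beta>) n) + (\<alpha> \<beta>) n \<cdot> \<delta> n\<close> is the sum of the terms
  \<open>\<alpha> a \<cdot> D (\<beta> b) + \<beta> b \<cdot> D (\<alpha> a) + \<alpha> a \<beta> b \<cdot> \<delta> a + \<alpha> a \<beta> b \<cdot> \<delta> b\<close>,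
  which regroup as \<open>\<alpha> a \<cdot> (D (\<beta> b) + \<beta> b \<cdot> \<delta> b)\<close> plus \<open>\<beta> b \<cdot> (D (\<alpha> a) + \<alpha> a \<cdot> \<delta> a)\<close>. The first
  part sums to the first product of the Leibniz rule; the second part sums to the other one after
  exchanging the two factors of each factorization, which is where commutativity of \<open>\<Gamma>\<close> enters
  (\<open>finsum_factorizations_swap\<close>, \<open>induced_der_leibniz\<close>).

  Linearity over \<open>A\<close>, and \<open>R\<close>-linearity in the pair \<open>(D, \<delta>)\<close>, reduce to pointwise identities,
  because convolution with a function concentrated at the unit of \<open>\<Gamma>\<close> is pointwise multiplication by
  its value there (\<open>fun_const_mult\<close>, \<open>fun_const_smult\<close>).

  Apart from the direct sum, the \<open>R\<close>-modules built here from \<open>M\<close> consist of functions with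
  pointwise operations, so \<open>pointwise_module\<close> reduces the module axioms to closure under these operations. For the
  derivations of the convolution ring only the scalars from \<open>R\<close> matter. Besides closure of
  the carriers, this requires of the convolution action only that it is additive in the module argument and commutes with
  these scalars (\<open>Der_restrict_scalars_module\<close>); associativity of convolution plays no part.
\<close>

section \<open>Modules of functions with pointwise operations\<close>

text \<open>Closure under negation is not required, since \<open>- f\<close> is the scalar multiple of \<open>f\<close>
  by \<open>- 1\<close>.\<close>

lemma (in module) pointwise_module:
  fixes P :: "('a, 'k \<Rightarrow> 'c, 'e) module_scheme"
  assumes carr: "carrier P \<subseteq> X \<rightarrow>\<^sub>E carrier M"
    and zero: "\<zero>\<^bsub>P\<^esub> = (\<lambda>x\<in>X. \<zero>\<^bsub>M\<^esub>)"
    and add: "\<And>f g. \<lbrakk>f \<in> carrier P; g \<in> carrier P\<rbrakk> \<Longrightarrow> f \<oplus>\<^bsub>P\<^esub> g = (\<lambda>x\<in>X. f x \<oplus>\<^bsub>M\<^esub> g x)"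
    and smult: "\<And>r f. \<lbrakk>r \<in> carrier R; f \<in> carrier P\<rbrakk> \<Longrightarrow> r \<odot>\<^bsub>P\<^esub> f = (\<lambda>x\<in>X. r \<odot>\<^bsub>M\<^esub> f x)"
    and zero_closed': "\<zero>\<^bsub>P\<^esub> \<in> carrier P"
    and add_closed': "\<And>f g. \<lbrakk>f \<in> carrier P; g \<in> carrier P\<rbrakk> \<Longrightarrow> f \<oplus>\<^bsub>P\<^esub> g \<in> carrier P"
    and smult_closed': "\<And>r f. \<lbrakk>r \<in> carrier R; f \<in> carrier P\<rbrakk> \<Longrightarrow> r \<odot>\<^bsub>P\<^esub> f \<in> carrier P"
  shows "module R P"
proof -
  have val: "f x \<in> carrier M" if "f \<in> carrier P" "x \<in> X" for f x
    using carr that by (auto simp: PiE_iff)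
  have eqI: "f = g" if "f \<in> carrier P" "g \<in> carrier P" "\<And>x. x \<in> X \<Longrightarrow> f x = g x" for f g
    using carr that by (meson PiE_ext subsetD)
  note closed = zero_closed' add_closed' smult_closed'
  have zero_app: "\<zero>\<^bsub>P\<^esub> x = \<zero>\<^bsub>M\<^esub>" if "x \<in> X" for x
    using that by (simp add: zero)
  have add_app: "(f \<oplus>\<^bsub>P\<^esub> g) x = f x \<oplus>\<^bsub>M\<^esub> g x"
    if "f \<in> carrier P" "g \<in> carrier P" "x \<in> X" for f g x
    using that by (simp add: add)
  have smult_app: "(r \<odot>\<^bsub>P\<^esub> f) x = r \<odot>\<^bsub>M\<^esub> f x"
    if "r \<in> carrier R" "f \<in> carrier P" "x \<in> X" for r f x
    using that by (simp add: smult)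
  note app = zero_app add_app smult_app
  show ?thesis
  proof (rule moduleI)
    show "abelian_group P"
    proof (rule abelian_groupI)
      show "\<exists>g\<in>carrier P. g \<oplus>\<^bsub>P\<^esub> f = \<zero>\<^bsub>P\<^esub>" if f: "f \<in> carrier P" for f
      proof (rule bexI)
        show "(\<ominus>\<^bsub>R\<^esub> \<one>\<^bsub>R\<^esub>) \<odot>\<^bsub>P\<^esub> f \<in> carrier P"
          using f by (simp add: closed)
        show "(\<ominus>\<^bsub>R\<^esub> \<one>\<^bsub>R\<^esub>) \<odot>\<^bsub>P\<^esub> f \<oplus>\<^bsub>P\<^esub> f = \<zero>\<^bsub>P\<^esub>"
          using f by (intro eqI) (simp_all add: closed app val smult_l_minus M.l_neg)
      qed
    qed (auto intro!: eqI simp: closed app val M.a_ac)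
  qed (auto intro!: eqI simp: closed app val smult_l_distr smult_r_distr smult_assoc1 R.is_cring)
qed

lemma module_sum_module:
  assumes "module R M" and "module R N"
  shows "module R (module_sum M N)"
proof -
  interpret M: module R M by fact
  interpret N: module R N by fact
  show ?thesis
  proof (rule moduleI)
    show "abelian_group (module_sum M N)"
    proof (rule abelian_groupI)
      show "\<exists>y\<in>carrier (module_sum M N). y \<oplus>\<^bsub>module_sum M N\<^esub> x = \<zero>\<^bsub>module_sum M N\<^esub>"
        if "x \<in> carrier (module_sum M N)" for x
        using that
        by (intro bexI[of _ "(\<ominus>\<^bsub>M\<^esub> fst x, \<ominus>\<^bsub>N\<^esub> snd x)"])
          (auto simp: module_sum_def M.M.l_neg N.M.l_neg)
    qed (auto simp: module_sum_def M.M.a_ac N.M.a_ac)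
  qed (auto simp: module_sum_def M.is_cring M.smult_l_distr M.smult_r_distr M.smult_assoc1
      N.smult_l_distr N.smult_r_distr N.smult_assoc1)
qed

lemma Hom_mod_module:
  assumes "module R M" and "comm_monoid \<Gamma>"
  shows "module R (Hom_mod \<Gamma> M)"
proof -
  interpret module R M by fact
  interpret G: comm_monoid \<Gamma> by fact
  show ?thesis
  proof (rule pointwise_module[where X = "carrier \<Gamma>"])
    show "carrier (Hom_mod \<Gamma> M) \<subseteq> carrier \<Gamma> \<rightarrow>\<^sub>E carrier M"
      by (auto simp only: Hom_mod_def monoid_homs_def partial_object.simps)
    show "\<delta> \<oplus>\<^bsub>Hom_mod \<Gamma> M\<^esub> \<epsilon> \<in> carrier (Hom_mod \<Gamma> M)"
      if "\<delta> \<in> carrier (Hom_mod \<Gamma> M)" "\<epsilon> \<in> carrier (Hom_mod \<Gamma> M)" for \<delta> \<epsilon>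
      using that by (auto simp: Hom_mod_def monoid_homs_def hom_def PiE_iff Pi_iff M.a_ac)
    show "r \<odot>\<^bsub>Hom_mod \<Gamma> M\<^esub> \<delta> \<in> carrier (Hom_mod \<Gamma> M)"
      if "r \<in> carrier R" "\<delta> \<in> carrier (Hom_mod \<Gamma> M)" for r \<delta>
      using that by (auto simp: Hom_mod_def monoid_homs_def hom_def PiE_iff Pi_iff smult_r_distr)
  qed (auto simp: Hom_mod_def monoid_homs_def hom_def PiE_iff)
qed

section \<open>Modules of derivations\<close>

text \<open>This is not immediate from the record: restriction of scalars also discards any fields that
  extend the module record.\<close>

lemma restrict_scalars_id_module:
  assumes "module R M"
  shows "module R (restrict_scalars id M)"
proof -
  interpret module R M by fact
  show ?thesis
  proof (rule moduleI)
    show "abelian_group (restrict_scalars id M)"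
    proof (rule abelian_groupI)
      show "\<exists>y\<in>carrier (restrict_scalars id M).
          y \<oplus>\<^bsub>restrict_scalars id M\<^esub> x = \<zero>\<^bsub>restrict_scalars id M\<^esub>"
        if "x \<in> carrier (restrict_scalars id M)" for x
        using that by (intro bexI[of _ "\<ominus>\<^bsub>M\<^esub> x"]) (auto simp: restrict_scalars_def M.l_neg)
    qed (auto simp: restrict_scalars_def M.a_ac)
  qed (auto simp: restrict_scalars_def R.is_cring smult_l_distr smult_r_distr smult_assoc1)
qed

text \<open>Neither is \<open>S\<close> assumed to be a ring nor \<open>N\<close> to be an \<open>S\<close>-module: for the derivations to form an
  \<open>R\<close>-module it is enough that \<open>S\<close> acts on \<open>N\<close> by additive maps that commute with the scalars
  from \<open>R\<close>.\<close>

lemma Der_restrict_scalars_module: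
  assumes N: "module R (restrict_scalars h N)"
    and S_add: "\<And>f g. \<lbrakk>f \<in> carrier S; g \<in> carrier S\<rbrakk> \<Longrightarrow> f \<oplus>\<^bsub>S\<^esub> g \<in> carrier S"
    and S_mult: "\<And>f g. \<lbrakk>f \<in> carrier S; g \<in> carrier S\<rbrakk> \<Longrightarrow> f \<otimes>\<^bsub>S\<^esub> g \<in> carrier S"
    and j: "\<And>a. a \<in> carrier A \<Longrightarrow> j a \<in> carrier S"
    and closed: "\<And>f x. \<lbrakk>f \<in> carrier S; x \<in> carrier N\<rbrakk> \<Longrightarrow> f \<odot>\<^bsub>N\<^esub> x \<in> carrier N"
    and distr: "\<And>f x y. \<lbrakk>f \<in> carrier S; x \<in> carrier N; y \<in> carrier N\<rbrakk>
      \<Longrightarrow> f \<odot>\<^bsub>N\<^esub> (x \<oplus>\<^bsub>N\<^esub> y) = f \<odot>\<^bsub>N\<^esub> x \<oplus>\<^bsub>N\<^esub> f \<odot>\<^bsub>N\<^esub> y"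
    and commute: "\<And>r f x. \<lbrakk>r \<in> carrier R; f \<in> carrier S; x \<in> carrier N\<rbrakk>
      \<Longrightarrow> h r \<odot>\<^bsub>N\<^esub> (f \<odot>\<^bsub>N\<^esub> x) = f \<odot>\<^bsub>N\<^esub> (h r \<odot>\<^bsub>N\<^esub> x)"
  shows "module R (restrict_scalars h (Der A S j N))"
proof -
  interpret N: module R "restrict_scalars h N" by fact
  let ?P = "restrict_scalars h (Der A S j N)"
  have [simp]: "carrier (restrict_scalars h N) = carrier N"
    "add (restrict_scalars h N) = add N" "\<zero>\<^bsub>restrict_scalars h N\<^esub> = \<zero>\<^bsub>N\<^esub>"
    by (simp_all add: restrict_scalars_def)
  note [simp] = N.M.a_closed[simplified] and zero [simp] = N.M.zero_closed[simplified]
  have ac: "(x \<oplus>\<^bsub>N\<^esub> y) \<oplus>\<^bsub>N\<^esub> (z \<oplus>\<^bsub>N\<^esub> w) = (x \<oplus>\<^bsub>N\<^esub> z) \<oplus>\<^bsub>N\<^esub> (y \<oplus>\<^bsub>N\<^esub> w)"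
    if "x \<in> carrier N" "y \<in> carrier N" "z \<in> carrier N" "w \<in> carrier N" for x y z w
    using that by (simp add: N.M.a_ac[simplified])
  have hr [simp]: "h r \<odot>\<^bsub>N\<^esub> x \<in> carrier N" if "r \<in> carrier R" "x \<in> carrier N" for r x
    using N.smult_closed that by (simp add: restrict_scalars_def)
  have hr_distr: "h r \<odot>\<^bsub>N\<^esub> (x \<oplus>\<^bsub>N\<^esub> y) = h r \<odot>\<^bsub>N\<^esub> x \<oplus>\<^bsub>N\<^esub> h r \<odot>\<^bsub>N\<^esub> y"
    if "r \<in> carrier R" "x \<in> carrier N" "y \<in> carrier N" for r x y
    using N.smult_r_distr that by (simp add: restrict_scalars_def)
  have null: "f \<odot>\<^bsub>N\<^esub> \<zero>\<^bsub>N\<^esub> = \<zero>\<^bsub>N\<^esub>" if "f \<in> carrier S" for f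
    using distr[OF that zero zero] closed[OF that zero] N.M.add.r_cancel_one'[simplified]
      N.M.l_zero[simplified] by simp
  show ?thesis
  proof (rule N.pointwise_module[where X = "carrier S"])
    show "carrier ?P \<subseteq> carrier S \<rightarrow>\<^sub>E carrier (restrict_scalars h N)"
      by (auto simp only: restrict_scalars_def Der_def derivations_def partial_object.simps)
    show "\<zero>\<^bsub>?P\<^esub> \<in> carrier ?P"
      by (auto simp: restrict_scalars_def Der_def derivations_def S_add S_mult j null
          N.M.l_zero[simplified])
    show "D \<oplus>\<^bsub>?P\<^esub> E \<in> carrier ?P" if "D \<in> carrier ?P" "E \<in> carrier ?P" for D E
      using that
      by (auto simp: restrict_scalars_def Der_def derivations_def PiE_iff S_add S_mult j closed distr ac)
    show "r \<odot>\<^bsub>?P\<^esub> D \<in> carrier ?P" if r: "r \<in> carrier R" and D: "D \<in> carrier ?P" for r D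
    proof -
      let ?rD = "\<lambda>f\<in>carrier S. h r \<odot>\<^bsub>N\<^esub> D f"
      have D: "D \<in> derivations A S j N"
        using D by (simp add: restrict_scalars_def Der_def)
      then have Dc: "D f \<in> carrier N" if "f \<in> carrier S" for f
        using that by (auto simp: derivations_def)
      have "?rD (j a \<otimes>\<^bsub>S\<^esub> f) = j a \<odot>\<^bsub>N\<^esub> ?rD f" if "a \<in> carrier A" "f \<in> carrier S" for a f
      proof -
        have "D (j a \<otimes>\<^bsub>S\<^esub> f) = j a \<odot>\<^bsub>N\<^esub> D f"
          using D that unfolding derivations_def by blast
        then show ?thesis
          using that r by (simp add: S_mult j Dc commute)
      qed
      moreover have "?rD (f \<otimes>\<^bsub>S\<^esub> g) = f \<odot>\<^bsub>N\<^esub> ?rD g \<oplus>\<^bsub>N\<^esub> g \<odot>\<^bsub>N\<^esub> ?rD f"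
        if "f \<in> carrier S" "g \<in> carrier S" for f g
        using that r D by (simp add: derivations_def S_mult Dc closed hr_distr commute)
      moreover have "?rD (f \<oplus>\<^bsub>S\<^esub> g) = ?rD f \<oplus>\<^bsub>N\<^esub> ?rD g" if "f \<in> carrier S" "g \<in> carrier S" for f g
        using that r D by (simp add: derivations_def S_add Dc hr_distr)
      moreover have "?rD \<in> carrier S \<rightarrow>\<^sub>E carrier N"
        using r by (auto simp: Dc)
      ultimately have "?rD \<in> derivations A S j N"
        unfolding derivations_def by blast
      then show ?thesis
        by (simp add: restrict_scalars_def Der_def)
    qed
  qed (auto simp: restrict_scalars_def Der_def derivations_def PiE_iff)
qed

lemma Der_module:
  assumes "module R M" and "i \<in> ring_hom A R"
  shows "module R (Der A R i M)"
proof -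
  interpret module R M by fact
  have "module R (restrict_scalars id (Der A R i M))"
  proof (rule Der_restrict_scalars_module[OF restrict_scalars_id_module[OF assms(1)]])
    show "id r \<odot>\<^bsub>M\<^esub> (f \<odot>\<^bsub>M\<^esub> x) = f \<odot>\<^bsub>M\<^esub> (id r \<odot>\<^bsub>M\<^esub> x)"
      if "r \<in> carrier R" "f \<in> carrier R" "x \<in> carrier M" for r f x
      using that smult_assoc1[symmetric] by (simp add: R.m_comm)
  qed (auto simp: smult_r_distr ring_hom_closed[OF assms(2)])
  then show ?thesis
    by (simp add: restrict_scalars_def Der_def)
qed

section \<open>Convolution\<close>

text \<open>A module and a commutative monoid over which convolution sums are finite.\<close>

locale convolution = module R M + \<Gamma>: comm_monoid \<Gamma>
  for R :: "('r, 'x) ring_scheme" and M :: "('r, 'm, 'z) module_scheme"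
    and \<Gamma> :: "('g, 'y) monoid_scheme" +
  assumes finite_type: "finite_type \<Gamma>"
begin

lemma finite_factorizations [simp]: "n \<in> carrier \<Gamma> \<Longrightarrow> finite (factorizations \<Gamma> n)"
  using finite_type by (simp add: finite_type_def)

lemma factorizationsD:
  assumes "p \<in> factorizations \<Gamma> n"
  shows "fst p \<in> carrier \<Gamma>" and "snd p \<in> carrier \<Gamma>" and "fst p \<otimes>\<^bsub>\<Gamma>\<^esub> snd p = n"
  using assms by (auto simp: factorizations_def)

lemma finsum_factorizations_swap:
  assumes "n \<in> carrier \<Gamma>" and "f \<in> factorizations \<Gamma> n \<rightarrow> carrier M"
  shows "(\<Oplus>\<^bsub>M\<^esub>p\<in>factorizations \<Gamma> n. f (prod.swap p)) = finsum M f (factorizations \<Gamma> n)"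
proof -
  have "prod.swap ` factorizations \<Gamma> n = factorizations \<Gamma> n"
    by (force simp: factorizations_def \<Gamma>.m_comm image_iff)
  then show ?thesis
    using M.finsum_reindex[of f prod.swap "factorizations \<Gamma> n"] assms(2) by simp
qed

text \<open>Only the factorization \<open>n = 1 n\<close> contributes to a sum supported on the pairs whose first
  component is the unit. The monoid \<open>N\<close> of values is arbitrary, so that the lemma applies both to
  \<open>R\<close> and to \<open>M\<close>.\<close>

lemma finsum_unit_factor:
  assumes "abelian_monoid N" and n: "n \<in> carrier \<Gamma>" and "f n \<in> carrier N"
    and t: "\<And>p. p \<in> factorizations \<Gamma> n \<Longrightarrow> t p = (if fst p = \<one>\<^bsub>\<Gamma>\<^esub> then f (snd p) else \<zero>\<^bsub>N\<^esub>)"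
  shows "(\<Oplus>\<^bsub>N\<^esub>p\<in>factorizations \<Gamma> n. t p) = f n"
proof -
  interpret N: abelian_monoid N by fact
  have "(\<Oplus>\<^bsub>N\<^esub>p\<in>factorizations \<Gamma> n. t p)
      = (\<Oplus>\<^bsub>N\<^esub>p\<in>factorizations \<Gamma> n. if (\<one>\<^bsub>\<Gamma>\<^esub>, n) = p then f n else \<zero>\<^bsub>N\<^esub>)"
    using assms(3) by (intro N.finsum_cong') (auto simp: t, auto simp: factorizations_def)
  also have "\<dots> = f n"
  proof (rule N.finsum_singleton[where f = "\<lambda>_. f n"])
    show "(\<one>\<^bsub>\<Gamma>\<^esub>, n) \<in> factorizations \<Gamma> n"
      using n by (simp add: factorizations_def)
  qed (use n assms(3) in auto)
  finally show ?thesis .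
qed

lemma fun_ring_apply [simp]:
  "\<lbrakk>\<alpha> \<in> carrier (fun_ring \<Gamma> R); n \<in> carrier \<Gamma>\<rbrakk> \<Longrightarrow> \<alpha> n \<in> carrier R"
  by (auto simp: fun_ring_def)

lemma fun_module_apply [simp]:
  "\<lbrakk>f \<in> carrier (fun_module \<Gamma> M); n \<in> carrier \<Gamma>\<rbrakk> \<Longrightarrow> f n \<in> carrier M"
  by (auto simp: fun_module_def)

lemma fun_const_closed: "r \<in> carrier R \<Longrightarrow> fun_const \<Gamma> R r \<in> carrier (fun_ring \<Gamma> R)"
  by (auto simp: fun_const_def fun_ring_def)

lemma fun_const_mult:
  assumes "r \<in> carrier R" and "\<alpha> \<in> carrier (fun_ring \<Gamma> R)"
  shows "fun_const \<Gamma> R r \<otimes>\<^bsub>fun_ring \<Gamma> R\<^esub> \<alpha> = (\<lambda>n\<in>carrier \<Gamma>. r \<otimes>\<^bsub>R\<^esub> \<alpha> n)"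
proof -
  have "(\<Oplus>\<^bsub>R\<^esub>p\<in>factorizations \<Gamma> n. fun_const \<Gamma> R r (fst p) \<otimes>\<^bsub>R\<^esub> \<alpha> (snd p)) = r \<otimes>\<^bsub>R\<^esub> \<alpha> n"
    if "n \<in> carrier \<Gamma>" for n
    using assms that
    by (intro finsum_unit_factor[OF R.abelian_monoid_axioms, where f = "\<lambda>n. r \<otimes>\<^bsub>R\<^esub> \<alpha> n"])
      (auto simp: fun_const_def factorizationsD)
  then show ?thesis
    by (auto simp: fun_ring_def intro!: restrict_ext)
qed

lemma fun_const_smult:
  assumes "r \<in> carrier R" and "f \<in> carrier (fun_module \<Gamma> M)"
  shows "fun_const \<Gamma> R r \<odot>\<^bsub>fun_module \<Gamma> M\<^esub> f = (\<lambda>n\<in>carrier \<Gamma>. r \<odot>\<^bsub>M\<^esub> f n)"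
proof -
  have "(\<Oplus>\<^bsub>M\<^esub>p\<in>factorizations \<Gamma> n. fun_const \<Gamma> R r (fst p) \<odot>\<^bsub>M\<^esub> f (snd p)) = r \<odot>\<^bsub>M\<^esub> f n"
    if "n \<in> carrier \<Gamma>" for n
    using assms that
    by (intro finsum_unit_factor[OF M.abelian_monoid_axioms, where f = "\<lambda>n. r \<odot>\<^bsub>M\<^esub> f n"])
      (auto simp: fun_const_def factorizationsD)
  then show ?thesis
    by (auto simp: fun_module_def intro!: restrict_ext)
qed

lemma convolution_term_closed:
  assumes "\<alpha> \<in> carrier (fun_ring \<Gamma> R)" and "f \<in> carrier (fun_module \<Gamma> M)"
  shows "(\<lambda>p. \<alpha> (fst p) \<odot>\<^bsub>M\<^esub> f (snd p)) \<in> factorizations \<Gamma> n \<rightarrow> carrier M"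
  using assms by (auto simp: factorizationsD)

lemma ring_convolution_term_closed:
  assumes "\<alpha> \<in> carrier (fun_ring \<Gamma> R)" and "\<beta> \<in> carrier (fun_ring \<Gamma> R)"
  shows "(\<lambda>p. \<alpha> (fst p) \<otimes>\<^bsub>R\<^esub> \<beta> (snd p)) \<in> factorizations \<Gamma> n \<rightarrow> carrier R"
  using assms by (auto simp: factorizationsD)

lemma fun_ring_add_closed:
  assumes "\<alpha> \<in> carrier (fun_ring \<Gamma> R)" and "\<beta> \<in> carrier (fun_ring \<Gamma> R)"
  shows "\<alpha> \<oplus>\<^bsub>fun_ring \<Gamma> R\<^esub> \<beta> \<in> carrier (fun_ring \<Gamma> R)"
  using assms by (auto simp: fun_ring_def PiE_iff)

lemma fun_ring_mult_closed:
  assumes "\<alpha> \<in> carrier (fun_ring \<Gamma> R)" and "\<beta> \<in> carrier (fun_ring \<Gamma> R)"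
  shows "\<alpha> \<otimes>\<^bsub>fun_ring \<Gamma> R\<^esub> \<beta> \<in> carrier (fun_ring \<Gamma> R)"
  using ring_convolution_term_closed[OF assms] by (simp add: fun_ring_def R.finsum_closed)

lemma fun_module_smult_closed:
  assumes "\<alpha> \<in> carrier (fun_ring \<Gamma> R)" and "f \<in> carrier (fun_module \<Gamma> M)"
  shows "\<alpha> \<odot>\<^bsub>fun_module \<Gamma> M\<^esub> f \<in> carrier (fun_module \<Gamma> M)"
  using convolution_term_closed[OF assms] by (simp add: fun_module_def M.finsum_closed)

lemma fun_module_smult_r_distr:
  assumes "\<alpha> \<in> carrier (fun_ring \<Gamma> R)"
    and "f \<in> carrier (fun_module \<Gamma> M)" and "g \<in> carrier (fun_module \<Gamma> M)"
  shows "\<alpha> \<odot>\<^bsub>fun_module \<Gamma> M\<^esub> (f \<oplus>\<^bsub>fun_module \<Gamma> M\<^esub> g)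
    = \<alpha> \<odot>\<^bsub>fun_module \<Gamma> M\<^esub> f \<oplus>\<^bsub>fun_module \<Gamma> M\<^esub> \<alpha> \<odot>\<^bsub>fun_module \<Gamma> M\<^esub> g"
proof -
  have "(\<Oplus>\<^bsub>M\<^esub>p\<in>factorizations \<Gamma> n. \<alpha> (fst p) \<odot>\<^bsub>M\<^esub> (\<lambda>n\<in>carrier \<Gamma>. f n \<oplus>\<^bsub>M\<^esub> g n) (snd p))
      = (\<Oplus>\<^bsub>M\<^esub>p\<in>factorizations \<Gamma> n. \<alpha> (fst p) \<odot>\<^bsub>M\<^esub> f (snd p))
        \<oplus>\<^bsub>M\<^esub> (\<Oplus>\<^bsub>M\<^esub>p\<in>factorizations \<Gamma> n. \<alpha> (fst p) \<odot>\<^bsub>M\<^esub> g (snd p))" for n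
    unfolding M.finsum_addf[OF convolution_term_closed[OF assms(1,2)]
        convolution_term_closed[OF assms(1,3)], symmetric]
    using assms by (intro M.finsum_cong') (auto simp: factorizationsD smult_r_distr)
  then show ?thesis
    by (auto simp: fun_module_def intro!: restrict_ext)
qed

lemma fun_const_smult_commute:
  assumes r: "r \<in> carrier R" and \<alpha>: "\<alpha> \<in> carrier (fun_ring \<Gamma> R)" and f: "f \<in> carrier (fun_module \<Gamma> M)"
  shows "fun_const \<Gamma> R r \<odot>\<^bsub>fun_module \<Gamma> M\<^esub> (\<alpha> \<odot>\<^bsub>fun_module \<Gamma> M\<^esub> f)
    = \<alpha> \<odot>\<^bsub>fun_module \<Gamma> M\<^esub> (fun_const \<Gamma> R r \<odot>\<^bsub>fun_module \<Gamma> M\<^esub> f)"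
proof -
  have "r \<odot>\<^bsub>M\<^esub> (\<Oplus>\<^bsub>M\<^esub>p\<in>factorizations \<Gamma> n. \<alpha> (fst p) \<odot>\<^bsub>M\<^esub> f (snd p))
      = (\<Oplus>\<^bsub>M\<^esub>p\<in>factorizations \<Gamma> n. \<alpha> (fst p) \<odot>\<^bsub>M\<^esub> (\<lambda>n\<in>carrier \<Gamma>. r \<odot>\<^bsub>M\<^esub> f n) (snd p))"
    if "n \<in> carrier \<Gamma>" for n
    unfolding finsum_smult_ldistr[OF finite_factorizations[OF that] r convolution_term_closed[OF \<alpha> f]]
    using assms
    by (intro M.finsum_cong') (auto simp: factorizationsD smult_assoc1[symmetric] R.m_comm)
  then show ?thesis
    unfolding fun_const_smult[OF r f] fun_const_smult[OF r fun_module_smult_closed[OF \<alpha> f]]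
    by (auto simp: fun_module_def intro!: restrict_ext)
qed

lemma fun_module_restrict_scalars_module:
  "module R (restrict_scalars (fun_const \<Gamma> R) (fun_module \<Gamma> M))"
proof (rule pointwise_module[where X = "carrier \<Gamma>"])
  let ?P = "restrict_scalars (fun_const \<Gamma> R) (fun_module \<Gamma> M)"
  show "r \<odot>\<^bsub>?P\<^esub> f = (\<lambda>n\<in>carrier \<Gamma>. r \<odot>\<^bsub>M\<^esub> f n)" if "r \<in> carrier R" "f \<in> carrier ?P" for r f
    using fun_const_smult that by (simp add: restrict_scalars_def)
  show "r \<odot>\<^bsub>?P\<^esub> f \<in> carrier ?P" if "r \<in> carrier R" "f \<in> carrier ?P" for r f
    using fun_module_smult_closed[OF fun_const_closed] that by (simp add: restrict_scalars_def)
qed (auto simp: restrict_scalars_def fun_module_def PiE_iff)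

lemma fun_Der_module:
  assumes "i \<in> ring_hom A R"
  shows "module R (restrict_scalars (fun_const \<Gamma> R)
    (Der A (fun_ring \<Gamma> R) (fun_const \<Gamma> R \<circ> i) (fun_module \<Gamma> M)))"
  using fun_module_restrict_scalars_module
  by (rule Der_restrict_scalars_module)
    (simp_all add: fun_ring_add_closed fun_ring_mult_closed fun_const_closed ring_hom_closed[OF assms]
      fun_module_smult_closed fun_module_smult_r_distr fun_const_smult_commute)

end

section \<open>The induced derivation\<close>

lemma additive_finsum:
  assumes "abelian_group G" and "abelian_group H"
    and closed: "D \<in> carrier G \<rightarrow> carrier H"
    and add: "\<And>x y. \<lbrakk>x \<in> carrier G; y \<in> carrier G\<rbrakk> \<Longrightarrow> D (x \<oplus>\<^bsub>G\<^esub> y) = D x \<oplus>\<^bsub>H\<^esub> D y"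
    and f: "f \<in> F \<rightarrow> carrier G"
  shows "D (finsum G f F) = (\<Oplus>\<^bsub>H\<^esub>x\<in>F. D (f x))"
proof -
  interpret G: abelian_group G by fact
  interpret H: abelian_group H by fact
  have "D \<zero>\<^bsub>G\<^esub> = \<zero>\<^bsub>H\<^esub>"
    using add[of "\<zero>\<^bsub>G\<^esub>" "\<zero>\<^bsub>G\<^esub>"] closed H.add.r_cancel_one'[of "D \<zero>\<^bsub>G\<^esub>" "D \<zero>\<^bsub>G\<^esub>"] by auto
  then show ?thesis
    using f closed by (induction F rule: infinite_finite_induct) (auto simp: add Pi_iff)
qed

context convolution
begin

lemma induced_der_closed:
  assumes "D \<in> carrier R \<rightarrow> carrier M" and "\<delta> \<in> carrier \<Gamma> \<rightarrow> carrier M"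
  shows "induced_der \<Gamma> R M D \<delta> \<in> carrier (fun_ring \<Gamma> R) \<rightarrow>\<^sub>E carrier (fun_module \<Gamma> M)"
  using assms by (auto simp: induced_der_def fun_ring_def fun_module_def PiE_iff Pi_iff)

lemma induced_der_apply:
  assumes "\<alpha> \<in> carrier (fun_ring \<Gamma> R)"
  shows "induced_der \<Gamma> R M D \<delta> \<alpha> = (\<lambda>n\<in>carrier \<Gamma>. D (\<alpha> n) \<oplus>\<^bsub>M\<^esub> \<alpha> n \<odot>\<^bsub>M\<^esub> \<delta> n)"
  using assms by (simp add: induced_der_def)

lemma induced_der_leibniz:
  assumes D: "D \<in> derivations A R i M" and \<delta>: "\<delta> \<in> monoid_homs \<Gamma> M"
    and \<alpha>: "\<alpha> \<in> carrier (fun_ring \<Gamma> R)" and \<beta>: "\<beta> \<in> carrier (fun_ring \<Gamma> R)"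
  shows "induced_der \<Gamma> R M D \<delta> (\<alpha> \<otimes>\<^bsub>fun_ring \<Gamma> R\<^esub> \<beta>)
    = \<alpha> \<odot>\<^bsub>fun_module \<Gamma> M\<^esub> induced_der \<Gamma> R M D \<delta> \<beta>
      \<oplus>\<^bsub>fun_module \<Gamma> M\<^esub> \<beta> \<odot>\<^bsub>fun_module \<Gamma> M\<^esub> induced_der \<Gamma> R M D \<delta> \<alpha>"
proof -
  let ?D = "induced_der \<Gamma> R M D \<delta>" and ?F = "factorizations \<Gamma>"
  have Dc [simp]: "D r \<in> carrier M" if "r \<in> carrier R" for r
    using D that by (auto simp: derivations_def)
  have \<delta>c [simp]: "\<delta> n \<in> carrier M" if "n \<in> carrier \<Gamma>" for n
    using \<delta> that by (auto simp: monoid_homs_def)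
  have D_add: "D (r \<oplus>\<^bsub>R\<^esub> s) = D r \<oplus>\<^bsub>M\<^esub> D s" if "r \<in> carrier R" "s \<in> carrier R" for r s
    using D that by (auto simp: derivations_def)
  have D_mult: "D (r \<otimes>\<^bsub>R\<^esub> s) = r \<odot>\<^bsub>M\<^esub> D s \<oplus>\<^bsub>M\<^esub> s \<odot>\<^bsub>M\<^esub> D r" if "r \<in> carrier R" "s \<in> carrier R" for r s
    using D that by (auto simp: derivations_def)
  have \<delta>_mult: "\<delta> (a \<otimes>\<^bsub>\<Gamma>\<^esub> b) = \<delta> a \<oplus>\<^bsub>M\<^esub> \<delta> b" if "a \<in> carrier \<Gamma>" "b \<in> carrier \<Gamma>" for a b
    using \<delta> that by (auto simp: monoid_homs_def hom_def)
  have \<alpha>c [simp]: "\<alpha> n \<in> carrier R" and \<beta>c [simp]: "\<beta> n \<in> carrier R" if "n \<in> carrier \<Gamma>" for n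
    using \<alpha> \<beta> that by (auto simp: fun_ring_def)
  have "D (\<Oplus>\<^bsub>R\<^esub>p\<in>?F n. \<alpha> (fst p) \<otimes>\<^bsub>R\<^esub> \<beta> (snd p))
        \<oplus>\<^bsub>M\<^esub> (\<Oplus>\<^bsub>R\<^esub>p\<in>?F n. \<alpha> (fst p) \<otimes>\<^bsub>R\<^esub> \<beta> (snd p)) \<odot>\<^bsub>M\<^esub> \<delta> n
      = (\<Oplus>\<^bsub>M\<^esub>p\<in>?F n. \<alpha> (fst p) \<odot>\<^bsub>M\<^esub> ?D \<beta> (snd p))
        \<oplus>\<^bsub>M\<^esub> (\<Oplus>\<^bsub>M\<^esub>p\<in>?F n. \<beta> (fst p) \<odot>\<^bsub>M\<^esub> ?D \<alpha> (snd p))" (is "?L = ?B1 \<oplus>\<^bsub>M\<^esub> ?B2")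
    if n: "n \<in> carrier \<Gamma>" for n
  proof -
    let ?t = "\<lambda>p. \<alpha> (fst p) \<otimes>\<^bsub>R\<^esub> \<beta> (snd p)"
    note F = factorizationsD[of _ n]
    have tc: "?t \<in> ?F n \<rightarrow> carrier R"
      using ring_convolution_term_closed[OF \<alpha> \<beta>] .
    have "?L = (\<Oplus>\<^bsub>M\<^esub>p\<in>?F n. D (?t p)) \<oplus>\<^bsub>M\<^esub> (\<Oplus>\<^bsub>M\<^esub>p\<in>?F n. ?t p \<odot>\<^bsub>M\<^esub> \<delta> n)"
      using n tc
        additive_finsum[OF R.abelian_group_axioms M.abelian_group_axioms, of D ?t "?F n"]
        additive_finsum[OF R.abelian_group_axioms M.abelian_group_axioms, of "\<lambda>r. r \<odot>\<^bsub>M\<^esub> \<delta> n" ?t "?F n"]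
      by (simp add: Pi_iff D_add smult_l_distr)
    also have "\<dots> = (\<Oplus>\<^bsub>M\<^esub>p\<in>?F n. D (?t p) \<oplus>\<^bsub>M\<^esub> ?t p \<odot>\<^bsub>M\<^esub> \<delta> n)"
      using n tc by (intro M.finsum_addf[symmetric]) (auto simp: Pi_iff)
    also have "\<dots> = (\<Oplus>\<^bsub>M\<^esub>p\<in>?F n. \<alpha> (fst p) \<odot>\<^bsub>M\<^esub> ?D \<beta> (snd p) \<oplus>\<^bsub>M\<^esub> \<beta> (snd p) \<odot>\<^bsub>M\<^esub> ?D \<alpha> (fst p))"
    proof (rule M.finsum_cong')
      fix p assume p: "p \<in> ?F n"
      obtain a b where ab: "p = (a, b)" "a \<in> carrier \<Gamma>" "b \<in> carrier \<Gamma>" "n = a \<otimes>\<^bsub>\<Gamma>\<^esub> b"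
        using p by (auto simp: factorizations_def)
      \<comment> \<open>The scalars of \<open>\<delta> a\<close> occur in opposite orders on the two sides.\<close>
      have "\<beta> b \<odot>\<^bsub>M\<^esub> (\<alpha> a \<odot>\<^bsub>M\<^esub> \<delta> a) = (\<alpha> a \<otimes>\<^bsub>R\<^esub> \<beta> b) \<odot>\<^bsub>M\<^esub> \<delta> a"
        using ab by (simp add: smult_assoc1[symmetric] R.m_comm)
      then show "D (?t p) \<oplus>\<^bsub>M\<^esub> ?t p \<odot>\<^bsub>M\<^esub> \<delta> n
          = \<alpha> (fst p) \<odot>\<^bsub>M\<^esub> ?D \<beta> (snd p) \<oplus>\<^bsub>M\<^esub> \<beta> (snd p) \<odot>\<^bsub>M\<^esub> ?D \<alpha> (fst p)"
        using ab by (simp add: induced_der_apply \<alpha> \<beta> D_mult \<delta>_mult smult_r_distr smult_assoc1 M.a_ac)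
    qed (auto simp: induced_der_apply \<alpha> \<beta> F)
    also have "\<dots> = ?B1 \<oplus>\<^bsub>M\<^esub> (\<Oplus>\<^bsub>M\<^esub>p\<in>?F n. \<beta> (snd p) \<odot>\<^bsub>M\<^esub> ?D \<alpha> (fst p))"
      by (intro M.finsum_addf) (auto simp: induced_der_apply \<alpha> \<beta> F)
    also have "(\<Oplus>\<^bsub>M\<^esub>p\<in>?F n. \<beta> (snd p) \<odot>\<^bsub>M\<^esub> ?D \<alpha> (fst p)) = ?B2"
      using finsum_factorizations_swap[OF n, of "\<lambda>p. \<beta> (fst p) \<odot>\<^bsub>M\<^esub> ?D \<alpha> (snd p)"]
      by (auto simp: induced_der_apply \<alpha> \<beta> F)
    finally show ?thesis .
  qed
  then show ?thesis
    unfolding induced_der_apply[OF fun_ring_mult_closed[OF \<alpha> \<beta>]]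
    by (auto simp: fun_ring_def fun_module_def intro!: restrict_ext)
qed

lemma induced_der_derivation:
  assumes i: "i \<in> ring_hom A R" and D: "D \<in> derivations A R i M" and \<delta>: "\<delta> \<in> monoid_homs \<Gamma> M"
  shows "induced_der \<Gamma> R M D \<delta> \<in> derivations A (fun_ring \<Gamma> R) (fun_const \<Gamma> R \<circ> i) (fun_module \<Gamma> M)"
proof -
  let ?D = "induced_der \<Gamma> R M D \<delta>" and ?S = "fun_ring \<Gamma> R" and ?N = "fun_module \<Gamma> M"
  have Dc: "D \<in> carrier R \<rightarrow> carrier M" and \<delta>c: "\<delta> \<in> carrier \<Gamma> \<rightarrow> carrier M"
    using D \<delta> by (auto simp: derivations_def monoid_homs_def)
  note closed = induced_der_closed[OF Dc \<delta>c]
  have "?D (\<alpha> \<oplus>\<^bsub>?S\<^esub> \<beta>) = ?D \<alpha> \<oplus>\<^bsub>?N\<^esub> ?D \<beta>" if "\<alpha> \<in> carrier ?S" "\<beta> \<in> carrier ?S" for \<alpha> \<beta>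
    unfolding induced_der_apply[OF that(1)] induced_der_apply[OF that(2)]
      induced_der_apply[OF fun_ring_add_closed[OF that]]
    using that D Dc \<delta>c
    by (auto simp: fun_ring_def fun_module_def PiE_iff Pi_iff derivations_def smult_l_distr M.a_ac
        intro!: restrict_ext)
  moreover have "?D ((fun_const \<Gamma> R \<circ> i) a \<otimes>\<^bsub>?S\<^esub> \<alpha>) = (fun_const \<Gamma> R \<circ> i) a \<odot>\<^bsub>?N\<^esub> ?D \<alpha>"
    if a: "a \<in> carrier A" and \<alpha>: "\<alpha> \<in> carrier ?S" for a \<alpha>
  proof -
    have ia: "i a \<in> carrier R"
      using i a by (rule ring_hom_closed)
    have "D (i a \<otimes>\<^bsub>R\<^esub> r) = i a \<odot>\<^bsub>M\<^esub> D r" if "r \<in> carrier R" for r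
      using D a that by (auto simp: derivations_def)
    moreover have "?D \<alpha> \<in> carrier ?N"
      using closed \<alpha> by auto
    moreover have "(\<lambda>n\<in>carrier \<Gamma>. i a \<otimes>\<^bsub>R\<^esub> \<alpha> n) \<in> carrier ?S"
      using ia \<alpha> by (auto simp: fun_ring_def)
    ultimately show ?thesis
      using ia \<alpha> Dc \<delta>c
      by (auto simp: fun_const_mult fun_const_smult induced_der_apply Pi_iff
          smult_assoc1 smult_r_distr intro!: restrict_ext)
  qed
  ultimately show ?thesis
    using closed induced_der_leibniz[OF D \<delta>] by (simp add: derivations_def)
qed

text \<open>Both \<open>D\<close> and \<open>\<delta>\<close> enter the defining formula linearly and in separate summands; hence the
  map is linear on the direct sum.\<close>

lemma induced_der_morphism:
  assumes i: "i \<in> ring_hom A R"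
  shows "module_morphism R (module_sum (Der A R i M) (Hom_mod \<Gamma> M))
    (restrict_scalars (fun_const \<Gamma> R)
      (Der A (fun_ring \<Gamma> R) (fun_const \<Gamma> R \<circ> i) (fun_module \<Gamma> M)))
    (\<lambda>(D, \<delta>). induced_der \<Gamma> R M D \<delta>)"
    (is "module_morphism R ?S ?T ?\<phi>")
proof (intro module_morphism.intro module_morphism_axioms.intro)
  show "module R ?S"
    by (intro module_sum_module Der_module Hom_mod_module module_axioms \<Gamma>.comm_monoid_axioms i)
  show "module R ?T"
    using i by (rule fun_Der_module)
  show "?\<phi> x \<in> carrier ?T" if "x \<in> carrier ?S" for x
    using that induced_der_derivation[OF i]
    by (auto simp: module_sum_def Der_def Hom_mod_def restrict_scalars_def)
  show "?\<phi> (x \<oplus>\<^bsub>?S\<^esub> y) = ?\<phi> x \<oplus>\<^bsub>?T\<^esub> ?\<phi> y" if xy_in: "x \<in> carrier ?S" "y \<in> carrier ?S" for x y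
  proof -
    obtain D \<delta> E \<epsilon> where xy: "x = (D, \<delta>)" "y = (E, \<epsilon>)"
      and DE: "D \<in> derivations A R i M" "E \<in> derivations A R i M"
      and \<delta>\<epsilon>: "\<delta> \<in> monoid_homs \<Gamma> M" "\<epsilon> \<in> monoid_homs \<Gamma> M"
      using xy_in by (auto simp: module_sum_def Der_def Hom_mod_def)
    have closed: "D \<in> carrier R \<rightarrow> carrier M" "E \<in> carrier R \<rightarrow> carrier M"
      "\<delta> \<in> carrier \<Gamma> \<rightarrow> carrier M" "\<epsilon> \<in> carrier \<Gamma> \<rightarrow> carrier M"
      using DE \<delta>\<epsilon> by (auto simp: derivations_def monoid_homs_def)
    have "induced_der \<Gamma> R M (D \<oplus>\<^bsub>Der A R i M\<^esub> E) (\<delta> \<oplus>\<^bsub>Hom_mod \<Gamma> M\<^esub> \<epsilon>) \<alpha>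
        = induced_der \<Gamma> R M D \<delta> \<alpha> \<oplus>\<^bsub>fun_module \<Gamma> M\<^esub> induced_der \<Gamma> R M E \<epsilon> \<alpha>"
      if "\<alpha> \<in> carrier (fun_ring \<Gamma> R)" for \<alpha>
      using that closed
      by (auto simp: induced_der_apply Der_def Hom_mod_def fun_module_def Pi_iff smult_r_distr M.a_ac
          intro!: restrict_ext)
    then show ?thesis
      using xy
      by (auto simp: module_sum_def restrict_scalars_def Der_def induced_der_def intro!: restrict_ext)
  qed
  show "?\<phi> (r \<odot>\<^bsub>?S\<^esub> x) = r \<odot>\<^bsub>?T\<^esub> ?\<phi> x" if r: "r \<in> carrier R" and x: "x \<in> carrier ?S" for r x
  proof -
    obtain D \<delta> where D: "x = (D, \<delta>)" "D \<in> derivations A R i M" "\<delta> \<in> monoid_homs \<Gamma> M"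
      using x by (auto simp: module_sum_def Der_def Hom_mod_def)
    have Dc: "D \<in> carrier R \<rightarrow> carrier M" and \<delta>c: "\<delta> \<in> carrier \<Gamma> \<rightarrow> carrier M"
      using D by (auto simp: derivations_def monoid_homs_def)
    have "induced_der \<Gamma> R M D \<delta> \<alpha> \<in> carrier (fun_module \<Gamma> M)" if "\<alpha> \<in> carrier (fun_ring \<Gamma> R)" for \<alpha>
      using induced_der_closed[OF Dc \<delta>c] that by auto
    moreover have "r \<odot>\<^bsub>M\<^esub> (s \<odot>\<^bsub>M\<^esub> m) = s \<odot>\<^bsub>M\<^esub> (r \<odot>\<^bsub>M\<^esub> m)" if "s \<in> carrier R" "m \<in> carrier M" for s m
      using r that by (simp add: smult_assoc1[symmetric] R.m_comm)
    ultimately have "induced_der \<Gamma> R M (r \<odot>\<^bsub>Der A R i M\<^esub> D) (r \<odot>\<^bsub>Hom_mod \<Gamma> M\<^esub> \<delta>) \<alpha>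
        = fun_const \<Gamma> R r \<odot>\<^bsub>fun_module \<Gamma> M\<^esub> induced_der \<Gamma> R M D \<delta> \<alpha>"
      if "\<alpha> \<in> carrier (fun_ring \<Gamma> R)" for \<alpha>
      using that r Dc \<delta>c
      by (auto simp: fun_const_smult induced_der_apply Der_def Hom_mod_def Pi_iff
          smult_r_distr intro!: restrict_ext)
    then show ?thesis
      using D(1)
      by (auto simp: module_sum_def restrict_scalars_def Der_def induced_der_def intro!: restrict_ext)
  qed
qed

end

theorem proposition1p7:
  fixes A :: "('a, 'w) ring_scheme"
    and R :: "('r, 'x) ring_scheme"
    and i :: "'a \<Rightarrow> 'r"
    and M :: "('r, 'm, 'z) module_scheme"
    and \<Gamma> :: "('g, 'y) monoid_scheme"
  assumes "cring A" and "cring R" and "i \<in> ring_hom A R"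
    and "module R M"
    and "comm_monoid \<Gamma>" and "finite_type \<Gamma>"
  shows "(\<forall>D \<in> derivations A R i M. \<forall>\<delta> \<in> monoid_homs \<Gamma> M.
            induced_der \<Gamma> R M D \<delta>
              \<in> derivations A (fun_ring \<Gamma> R) (fun_const \<Gamma> R \<circ> i) (fun_module \<Gamma> M))
       \<and> module R (Hom_mod \<Gamma> M)
       \<and> module_morphism R
            (module_sum (Der A R i M) (Hom_mod \<Gamma> M))
            (restrict_scalars (fun_const \<Gamma> R)
              (Der A (fun_ring \<Gamma> R) (fun_const \<Gamma> R \<circ> i) (fun_module \<Gamma> M)))
            (\<lambda>(D, \<delta>). induced_der \<Gamma> R M D \<delta>)"
proof -
  interpret convolution R M \<Gamma>
    using assms by (simp add: convolution_def convolution_axioms_def)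
  show ?thesis
    using assms by (simp add: induced_der_derivation Hom_mod_module induced_der_morphism)
qed

end
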